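(* Let $\varphi:(0,+\infty)\to(0,+\infty)$ be a function and suppose that $G:\mathbb{R}^n\setminus\{0\}\to(0,+\infty)$ is radial, i.e. $G(y)=G(|y|)$ (using the same letter for the function on $(0,+\infty)$). Assume that whenever $$\varphi(\lambda s_1)\,G(\lambda s_2)\le\varphi(s_1)\,G(s_2)\,\lambda^{1-n}$$ holds for some positive numbers $s_1,s_2,\lambda$, one must have $\lambda\ge1$. Let $f:\mathbb{S}^{n-1}\to(0,+\infty)$. Then the solution of the equation $$\det(\nabla^2h+hI)\,G(\overline{\nabla}h)\,\varphi(h)=f\quad\text{on }\mathbb{S}^{n-1}$$ is unique, i.e. any two solutions $h_1,h_2$ satisfy $h_1\equiv h_2$.
   Context: $n\ge2$. $\nabla,\nabla^2$ denote the covariant gradient and Hessian on the unit sphere $\mathbb{S}^{n-1}\subset\mathbb{R}^n$ in a local orthonormal frame, $I$ is the $(n-1)\times(n-1)$ identity matrix, and $\overline{\nabla}h(x):=\nabla h(x)+h(x)x\in\mathbb{R}^n$. In the paper $\varphi$, $G$ are positive and continuous and $f$ is positive. A solution means a positive $C^2$ function $h$ on $\mathbb{S}^{n-1}$ that is the support function of a convex body containing the origin in its interior, with $\nabla^2h+hI$ positive definite, satisfying the equation at every point. *)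

theory Defs
  imports "HOL-Analysis.Analysis" "Jordan_Normal_Form.Determinant"
begin

(* Vectors of \<real>^n are real^'n with n = CARD('n); the inner product is written inner, and the
   (n-1) x (n-1) matrices are those of Jordan_Normal_Form, since their size is not a type. *)

abbreviation usphere :: "(real^'n) set" where
  "usphere \<equiv> sphere 0 1"

definition tan_proj :: "real^'n \<Rightarrow> real^'n \<Rightarrow> real^'n" where
  "tan_proj x v = v - inner v x *\<^sub>R x"

(* A derivative within the sphere is determined on the tangent space only (its value in the
   normal direction is arbitrary); the condition inner g x = 0 makes the representing vector
   unique. *)
definition sph_grad :: "(real^'n \<Rightarrow> real) \<Rightarrow> real^'n \<Rightarrow> real^'n" where
  "sph_grad h x =
    (THE g. inner g x = 0 \<and> (h has_derivative (\<lambda>v. inner g v)) (at x within usphere))"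

(* Levi-Civita derivative on the sphere: tangential part of the derivative of a vector field X
   along the sphere. Only meaningful for u tangent at x, where the value of
   frechet_derivative does not depend on the choice it makes. *)
definition cov_deriv :: "(real^'n \<Rightarrow> real^'n) \<Rightarrow> real^'n \<Rightarrow> real^'n \<Rightarrow> real^'n" where
  "cov_deriv X x u = tan_proj x (frechet_derivative X (at x within usphere) u)"

(* The covariant Hessian as a bilinear form on tangent vectors u, v at x. *)
definition sph_hess :: "(real^'n \<Rightarrow> real) \<Rightarrow> real^'n \<Rightarrow> real^'n \<Rightarrow> real^'n \<Rightarrow> real" where
  "sph_hess h x u v = inner (cov_deriv (sph_grad h) x u) v"

(* Continuity of the gradient follows from its differentiability. *)
definition C2_on_sphere :: "(real^'n \<Rightarrow> real) \<Rightarrow> bool" where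
  "C2_on_sphere h \<longleftrightarrow>
     h differentiable_on usphere \<and>
     sph_grad h differentiable_on usphere \<and>
     (\<forall>u v. continuous_on usphere (\<lambda>x. sph_hess h x (tan_proj x u) (tan_proj x v)))"

definition grad_bar :: "(real^'n \<Rightarrow> real) \<Rightarrow> real^'n \<Rightarrow> real^'n" where
  "grad_bar h x = sph_grad h x + h x *\<^sub>R x"

(* e 0, ..., e (n-2) is an orthonormal basis of the tangent space at x. *)
definition orthonormal_frame :: "real^'n \<Rightarrow> (nat \<Rightarrow> real^'n) \<Rightarrow> bool" where
  "orthonormal_frame x e \<longleftrightarrow>
     (\<forall>i < CARD('n) - 1. inner (e i) x = 0) \<and>
     (\<forall>i < CARD('n) - 1. \<forall>j < CARD('n) - 1. inner (e i) (e j) = (if i = j then 1 else 0))"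

definition hess_mat :: "(real^'n \<Rightarrow> real) \<Rightarrow> real^'n \<Rightarrow> (nat \<Rightarrow> real^'n) \<Rightarrow> real Matrix.mat" where
  "hess_mat h x e = Matrix.mat (CARD('n) - 1) (CARD('n) - 1) (\<lambda>(i, j). sph_hess h x (e i) (e j))"

definition hess_plus_mat :: "(real^'n \<Rightarrow> real) \<Rightarrow> real^'n \<Rightarrow> (nat \<Rightarrow> real^'n) \<Rightarrow> real Matrix.mat" where
  "hess_plus_mat h x e = hess_mat h x e + h x \<cdot>\<^sub>m 1\<^sub>m (CARD('n) - 1)"

(* Positive definiteness is a notion for symmetric matrices. *)
definition positive_definite_mat :: "real Matrix.mat \<Rightarrow> bool" where
  "positive_definite_mat A \<longleftrightarrow>
     square_mat A \<and> transpose_mat A = A \<and>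
     (\<forall>v \<in> carrier_vec (dim_row A). v \<noteq> 0\<^sub>v (dim_row A) \<longrightarrow> scalar_prod v (A *\<^sub>v v) > 0)"

definition is_support_function :: "(real^'n \<Rightarrow> real) \<Rightarrow> (real^'n) set \<Rightarrow> bool" where
  "is_support_function h K \<longleftrightarrow> (\<forall>x \<in> usphere. h x = (SUP y\<in>K. inner x y))"

(* Functions on the sphere, on \<real>^n minus the origin and on (0, \<infinity>) are total functions here; only
   their values on these sets matter. *)
definition is_solution ::
  "(real \<Rightarrow> real) \<Rightarrow> (real^'n \<Rightarrow> real) \<Rightarrow> (real^'n \<Rightarrow> real) \<Rightarrow> (real^'n \<Rightarrow> real) \<Rightarrow> bool" where
  "is_solution \<phi> G f h \<longleftrightarrow>
     (\<forall>x \<in> usphere. h x > 0) \<and>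
     C2_on_sphere h \<and>
     (\<exists>K. convex K \<and> compact K \<and> 0 \<in> interior K \<and> is_support_function h K) \<and>
     (\<forall>x \<in> usphere. \<forall>e. orthonormal_frame x e \<longrightarrow>
        positive_definite_mat (hess_plus_mat h x e) \<and>
        Determinant.det (hess_plus_mat h x e) * G (grad_bar h x) * \<phi> (h x) = f x)"

end

theory Submission
  imports Defs
begin

(* At a maximum point x of h1/h2, with value \<lambda>, the function h1 - \<lambda> h2 attains its maximum 0. Hence
   there h1 = \<lambda> h2, the gradients satisfy the same relation, and the Hessian of h1 is at most \<lambda>
   times that of h2. Monotonicity of the determinant on positive definite matrices turns the two
   equations at x into the premise of the scaling hypothesis for \<mu> = 1/\<lambda>, so \<lambda> \<le> 1 and h1 \<le> h2;
   exchanging the solutions gives equality. *)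

section \<open>Monotonicity of the determinant\<close>

text \<open>Coefficients are a function on all pairs of indices, so that deleting the first row and
  column in an induction on \<open>n\<close> is a plain shift by \<open>Suc\<close>.\<close>

definition qform :: "nat \<Rightarrow> (nat \<Rightarrow> nat \<Rightarrow> real) \<Rightarrow> (nat \<Rightarrow> real) \<Rightarrow> real" where
  "qform n A v = (\<Sum>i<n. \<Sum>j<n. A i j * v i * v j)"

definition schur_compl :: "(nat \<Rightarrow> nat \<Rightarrow> real) \<Rightarrow> nat \<Rightarrow> nat \<Rightarrow> real" where
  "schur_compl A i j = A (Suc i) (Suc j) - A (Suc i) 0 * A 0 (Suc j) / A 0 0"

text \<open>Completing the square in the variable \<open>v 0\<close>. By symmetry the row and column
  cross terms combine to \<open>2 * v 0 * b\<close>, and the surplus \<open>b * b / A 0 0\<close> of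
  the square is what the Schur complement subtracts.\<close>

lemma qform_Suc:
  assumes sym: "\<And>i j. A i j = A j i" and a: "A 0 0 \<noteq> 0"
  shows "qform (Suc n) A v =
    A 0 0 * (v 0 + (\<Sum>j<n. A 0 (Suc j) * v (Suc j)) / A 0 0)\<^sup>2 + qform n (schur_compl A) (\<lambda>i. v (Suc i))"
proof -
  define b where "b = (\<Sum>j<n. A 0 (Suc j) * v (Suc j))"
  have b': "b = (\<Sum>j<n. A (Suc j) 0 * v (Suc j))"
    unfolding b_def using sym by simp
  have "qform (Suc n) A v = A 0 0 * (v 0)\<^sup>2 + 2 * v 0 * b
      + (\<Sum>i<n. \<Sum>j<n. A (Suc i) (Suc j) * v (Suc i) * v (Suc j))"
  proof -
    have 1: "(\<Sum>j<n. A 0 (Suc j) * v 0 * v (Suc j)) = v 0 * b"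
      unfolding b_def by (simp add: sum_distrib_left mult_ac)
    have 2: "(\<Sum>j<n. A (Suc j) 0 * v (Suc j) * v 0) = v 0 * b"
      unfolding b' by (simp add: sum_distrib_left mult_ac)
    show ?thesis
      unfolding qform_def sum.lessThan_Suc_shift sum.distrib 1 2
      by (simp add: power2_eq_square algebra_simps)
  qed
  moreover have "qform n (schur_compl A) (\<lambda>i. v (Suc i)) =
      (\<Sum>i<n. \<Sum>j<n. A (Suc i) (Suc j) * v (Suc i) * v (Suc j)) - b * b / A 0 0"
  proof -
    have "b * b / A 0 0 = (\<Sum>i<n. \<Sum>j<n. A (Suc i) 0 * A 0 (Suc j) / A 0 0 * v (Suc i) * v (Suc j))"
      by (subst b', unfold b_def sum_product sum_divide_distrib) (simp add: mult_ac)
    then show ?thesis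
      by (simp add: qform_def schur_compl_def left_diff_distrib sum_subtractf)
  qed
  moreover have "A 0 0 * (v 0 + b / A 0 0)\<^sup>2 = A 0 0 * (v 0)\<^sup>2 + 2 * v 0 * b + b * b / A 0 0"
    using a by (simp add: power2_eq_square field_simps)
  ultimately show ?thesis
    by (simp add: b_def)
qed

text \<open>One step of Gaussian elimination as a block factorization: \<open>?L\<close> is unit
  lower triangular, and \<open>?U\<close> is block upper triangular with diagonal blocks
  \<open>?a\<close> and \<open>?S\<close>.\<close>

lemma det_schur_compl:
  assumes a: "A 0 0 \<noteq> (0::real)"
  shows "Determinant.det (Matrix.mat (Suc n) (Suc n) (\<lambda>(i, j). A i j)) =
    A 0 0 * Determinant.det (Matrix.mat n n (\<lambda>(i, j). schur_compl A i j))"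
proof -
  let ?a = "Matrix.mat 1 1 (\<lambda>_. A 0 0)"
  let ?r = "Matrix.mat 1 n (\<lambda>(i, j). A 0 (Suc j))"
  let ?c = "Matrix.mat n 1 (\<lambda>(i, j). A (Suc i) 0 / A 0 0)"
  let ?S = "Matrix.mat n n (\<lambda>(i, j). schur_compl A i j)"
  let ?L = "four_block_mat (1\<^sub>m 1) (0\<^sub>m 1 n) ?c (1\<^sub>m n)"
  let ?U = "four_block_mat ?a ?r (0\<^sub>m n 1) ?S"
  have "?L * ?U = four_block_mat (1\<^sub>m 1 * ?a + 0\<^sub>m 1 n * 0\<^sub>m n 1) (1\<^sub>m 1 * ?r + 0\<^sub>m 1 n * ?S)
      (?c * ?a + 1\<^sub>m n * 0\<^sub>m n 1) (?c * ?r + 1\<^sub>m n * ?S)"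
    by (rule mult_four_block_mat) auto
  also have "\<dots> = Matrix.mat (Suc n) (Suc n) (\<lambda>(i, j). A i j)"
    using a by (intro eq_matI)
      (auto simp: scalar_prod_def schur_compl_def Suc_diff_Suc split: nat.split)
  finally have "Matrix.mat (Suc n) (Suc n) (\<lambda>(i, j). A i j) = ?L * ?U" ..
  moreover have "?L \<in> carrier_mat (1 + n) (1 + n)" "?U \<in> carrier_mat (1 + n) (1 + n)"
    by (auto intro!: four_block_carrier_mat)
  moreover have "Determinant.det ?L = 1"
    by (subst det_four_block_mat_upper_right_zero[where n = 1 and m = n]) auto
  moreover have "Determinant.det ?U = A 0 0 * Determinant.det ?S"
    by (subst det_four_block_mat_lower_left_zero[where n = 1 and m = n]) (auto simp: det_single)
  ultimately show ?thesis
    by (simp add: det_mult)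
qed

text \<open>Induction on the size: the determinant is the pivot \<open>A 0 0\<close> times the
  determinant of the Schur complement, and both factors are positive and grow with the quadratic
  form.\<close>

lemma det_mono_posdef:
  assumes "\<And>i j. A i j = A j i" "\<And>i j. B i j = B j i"
    and "\<And>v. \<exists>i<n. v i \<noteq> 0 \<Longrightarrow> 0 < qform n A v"
    and "\<And>v. qform n A v \<le> qform n B v"
  shows "0 < Determinant.det (Matrix.mat n n (\<lambda>(i, j). A i j)) \<and>
    Determinant.det (Matrix.mat n n (\<lambda>(i, j). A i j)) \<le> Determinant.det (Matrix.mat n n (\<lambda>(i, j). B i j))"
  using assms
proof (induction n arbitrary: A B)
  case 0
  then show ?case by simp
next
  case (Suc n)
  \<comment> \<open>The first unit vector; evaluating both forms there compares the pivots.\<close>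
  let ?e = "\<lambda>i::nat. if i = 0 then 1 else (0::real)"
  have q: "qform (Suc n) M ?e = M 0 0" for M
    by (simp add: qform_def sum.lessThan_Suc_shift del: sum.lessThan_Suc)
  have a: "0 < A 0 0" and ab: "A 0 0 \<le> B 0 0"
    using Suc.prems(3)[of ?e] Suc.prems(4)[of ?e] unfolding q by auto
  (* The Schur complement is the minimum of the quadratic form over the first coordinate, attained
     at ext M w, so it inherits both positivity and the order. *)
  define ext where "ext M w = case_nat (- (\<Sum>j<n. M 0 (Suc j) * w j) / M 0 0) w"
    for M :: "nat \<Rightarrow> nat \<Rightarrow> real" and w :: "nat \<Rightarrow> real"
  note QA = qform_Suc[of A n, OF Suc.prems(1)] and QB = qform_Suc[of B n, OF Suc.prems(2)]
  have extA: "qform (Suc n) A (ext A w) = qform n (schur_compl A) w" for w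
    using a by (subst QA) (auto simp: ext_def)
  have extB: "qform (Suc n) B (ext B w) = qform n (schur_compl B) w" for w
    using a ab by (subst QB) (auto simp: ext_def)
  have pos: "0 < qform n (schur_compl A) w" if "\<exists>i<n. w i \<noteq> 0" for w
  proof -
    from that obtain i where "i < n" "w i \<noteq> 0" by blast
    then have "Suc i < Suc n" "ext A w (Suc i) \<noteq> 0" by (auto simp: ext_def)
    then show ?thesis
      using Suc.prems(3)[of "ext A w"] unfolding extA by blast
  qed
  have le: "qform n (schur_compl A) w \<le> qform n (schur_compl B) w" for w
  proof -
    \<comment> \<open>The dropped square is nonnegative. Evaluating at the minimizer for
      \<open>B\<close>, not for \<open>A\<close>, makes the square for \<open>B\<close> vanish in
      the next step.\<close>
    have "qform n (schur_compl A) w \<le> qform (Suc n) A (ext B w)"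
      using a by (subst QA) (auto simp: ext_def)
    also have "\<dots> \<le> qform n (schur_compl B) w"
      using Suc.prems(4) extB by metis
    finally show ?thesis .
  qed
  have sA: "schur_compl A i j = schur_compl A j i" and sB: "schur_compl B i j = schur_compl B j i" for i j
    unfolding schur_compl_def using Suc.prems(1,2) by (metis mult.commute)+
  from Suc.IH[of "schur_compl A" "schur_compl B", OF sA sB pos le]
  show ?case
    using a ab by (simp add: det_schur_compl mult_mono)
qed

section \<open>Calculus on the sphere\<close>

lemma great_circle_in_sphere:
  fixes x u :: "real^'n"
  assumes "norm x = 1" "norm u = 1" "inner u x = 0"
  shows "cos t *\<^sub>R x + sin t *\<^sub>R u \<in> usphere"
proof -
  have "inner x x = 1" "inner u u = 1"
    using assms by (simp_all add: dot_square_norm)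
  then have "inner (cos t *\<^sub>R x + sin t *\<^sub>R u) (cos t *\<^sub>R x + sin t *\<^sub>R u) = cos t * cos t + sin t * sin t"
    using assms(3) by (simp add: inner_add inner_commute)
  also have "\<dots> = 1"
    by (simp flip: power2_eq_square)
  finally show ?thesis
    by (simp add: norm_eq_sqrt_inner)
qed

text \<open>Reduces differentiation within the sphere to one real variable. The curve stays on the
  sphere for all times, so the result is a full derivative at \<open>t\<close>, where uniqueness and
  extremum tests apply.\<close>

lemma has_vector_derivative_great_circle:
  fixes x u :: "real^'n"
  assumes "norm x = 1" "norm u = 1" "inner u x = 0"
    and F: "(F has_derivative F') (at (cos t *\<^sub>R x + sin t *\<^sub>R u) within usphere)"
  shows "((\<lambda>s. F (cos s *\<^sub>R x + sin s *\<^sub>R u)) has_vector_derivative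
    F' (cos t *\<^sub>R u - sin t *\<^sub>R x)) (at t)"
proof -
  let ?c = "\<lambda>s. cos s *\<^sub>R x + sin s *\<^sub>R u"
  have "(?c has_vector_derivative cos t *\<^sub>R u - sin t *\<^sub>R x) (at t)"
    by (auto intro!: derivative_eq_intros)
  moreover have "(F has_derivative F') (at (?c t) within range ?c)"
    using F by (rule has_derivative_subset) (use assms(1-3) great_circle_in_sphere in blast)
  ultimately show ?thesis
    using vector_derivative_diff_chain_within[of ?c _ t UNIV F F'] by (simp add: o_def)
qed

text \<open>Both linear maps compute the velocity of \<open>F\<close> along the great circle leaving
  \<open>x\<close> in direction \<open>u\<close>, and such a velocity is unique. Normal directions
  are excluded because no curve on the sphere has a nonzero normal velocity.\<close>

lemma sphere_derivative_unique:
  fixes x :: "real^'n"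
  assumes x: "norm x = 1" and u: "inner u x = 0"
    and F: "(F has_derivative F1) (at x within usphere)" "(F has_derivative F2) (at x within usphere)"
  shows "F1 u = F2 u"
proof (cases "u = 0")
  case True
  then show ?thesis
    using F by (simp add: has_derivative_linear linear_0)
next
  case False
  define w where "w = u /\<^sub>R norm u"
  have w: "norm w = 1" "inner w x = 0" "u = norm u *\<^sub>R w"
    using False u by (auto simp: w_def)
  have "F1 w = F2 w"
    using has_vector_derivative_great_circle[of x w F F1 0] has_vector_derivative_great_circle[of x w F F2 0] x w F
    by (auto intro: vector_derivative_unique_at)
  then show ?thesis
    using F[THEN has_derivative_linear] by (subst (1 2) w(3)) (simp add: linear_scale)
qed

text \<open>On the sphere this function differs from 1 by half the squared distance to
  \<open>x\<close>, a second-order quantity. It lets the normal part of a derivative be changed at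
  will.\<close>

lemma has_derivative_inner_within_sphere:
  fixes x :: "real^'n"
  assumes "x \<in> usphere"
  shows "((\<lambda>y. inner x y) has_derivative (\<lambda>_. 0)) (at x within usphere)"
proof (rule has_derivative_transform[OF assms])
  show "inner x y = 1 - inner (y - x) (y - x) / 2" if "y \<in> usphere" for y
  proof -
    have "inner x x = 1" "inner y y = 1"
      using assms that by (simp_all add: dot_square_norm)
    then show ?thesis
      by (simp add: inner_diff inner_commute field_simps)
  qed
  show "((\<lambda>y. 1 - inner (y - x) (y - x) / 2) has_derivative (\<lambda>_. 0)) (at x within usphere)"
    by (auto intro!: derivative_eq_intros)
qed

text \<open>Shows that the definite description defining the gradient is meaningful: a representing
  vector can be made tangent by removing its normal part, and two tangent ones agree when tested
  against their difference.\<close>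

lemma sph_grad:
  fixes h :: "real^'n \<Rightarrow> real"
  assumes x: "x \<in> usphere" and h: "h differentiable (at x within usphere)"
  shows "inner (sph_grad h x) x = 0"
    and "(h has_derivative (\<lambda>v. inner (sph_grad h x) v)) (at x within usphere)"
proof -
  let ?P = "\<lambda>g. inner g x = 0 \<and> (h has_derivative (\<lambda>v. inner g v)) (at x within usphere)"
  have xx: "inner x x = 1"
    using x by (simp add: dot_square_norm)
  obtain D where D: "(h has_derivative D) (at x within usphere)"
    using h by (auto simp: differentiable_def)
  \<comment> \<open>The adjoint applied to 1 is the Riesz vector of the functional
    \<open>D\<close>.\<close>
  define g where "g = adjoint D 1"
  have g: "D v = inner g v" for v
    using adjoint_works[OF has_derivative_linear[OF D], of v 1] by (simp add: g_def inner_commute)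
  \<comment> \<open>The same term is subtracted and added back, but differentiated once as an
    ambient linear function and once with derivative 0 within the sphere. The net effect is to
    project \<open>g\<close> to the tangent space.\<close>
  have "((\<lambda>y. (h y - inner g x * inner x y) + inner g x * inner x y) has_derivative
      (\<lambda>v. (D v - inner g x * inner x v) + inner g x * 0)) (at x within usphere)"
    by (intro has_derivative_add has_derivative_diff D has_derivative_mult_right
        has_derivative_inner_within_sphere x has_derivative_inner_right has_derivative_ident)
  then have "?P (tan_proj x g)"
    by (simp add: tan_proj_def g inner_diff xx)
  moreover have "g1 = g2" if "?P g1" "?P g2" for g1 g2
  proof -
    have "inner g1 (g1 - g2) = inner g2 (g1 - g2)"
      by (rule sphere_derivative_unique[where x = x and F = h]) (use x that in \<open>auto simp: inner_diff\<close>)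
    then have "inner (g1 - g2) (g1 - g2) = 0"
      by (simp add: inner_diff_left)
    then show ?thesis by simp
  qed
  ultimately have "?P (sph_grad h x)"
    unfolding sph_grad_def by (intro theI[of ?P]) blast+
  then show "inner (sph_grad h x) x = 0"
    and "(h has_derivative (\<lambda>v. inner (sph_grad h x) v)) (at x within usphere)"
    by auto
qed

section \<open>Second-order comparison at a touching point\<close>

lemma second_derivative_at_max:
  fixes f f' :: "real \<Rightarrow> real"
  assumes f: "\<And>t. (f has_real_derivative f' t) (at t)"
    and f': "(f' has_real_derivative c) (at 0)"
    and max: "\<And>t. f t \<le> f 0"
  shows "f' 0 = 0" and "c \<le> 0"
proof -
  show 0: "f' 0 = 0"
    using DERIV_local_max[of f "f' 0" 0 1] f max by simp
  show "c \<le> 0"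
  \<comment> \<open>Since \<open>f'\<close> is differentiable at 0 only, its sign is used: if
    \<open>c\<close> were positive, \<open>f'\<close> would be positive just to the right of 0, and
    \<open>f\<close> would exceed its maximum there.\<close>
  proof (rule ccontr)
    assume "\<not> c \<le> 0"
    then obtain d where d: "d > 0" "\<And>t. 0 < t \<Longrightarrow> t < d \<Longrightarrow> 0 < f' t"
      using DERIV_pos_inc_right[OF f'] 0 by auto
    have "f 0 < f (d / 2)"
    proof (rule DERIV_pos_imp_increasing_open[of 0 "d / 2" f])
      show "\<exists>y. (f has_real_derivative y) (at t) \<and> 0 < y" if "0 < t" "t < d / 2" for t
        using f d that by (intro exI[of _ "f' t"]) auto
      show "continuous_on {0..d / 2} f"
        using f by (meson DERIV_continuous continuous_at_imp_continuous_on)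
    qed (use d in simp)
    then show False
      using max[of "d / 2"] by simp
  qed
qed

lemma sph_hess_tangent:
  assumes "inner v x = 0"
  shows "sph_hess h x u v = inner (frechet_derivative (sph_grad h) (at x within usphere) u) v"
  using assms by (simp add: sph_hess_def cov_deriv_def tan_proj_def inner_diff inner_commute)

lemma sph_hess_scale:
  assumes "sph_grad h differentiable (at x within usphere)"
  shows "sph_hess h x (c *\<^sub>R u) (c *\<^sub>R u) = c\<^sup>2 * sph_hess h x u u"
proof -
  have "linear (frechet_derivative (sph_grad h) (at x within usphere))"
    using assms by (rule linear_frechet_derivative)
  then show ?thesis
    by (simp add: sph_hess_def cov_deriv_def tan_proj_def linear_scale inner_diff power2_eq_square
        right_diff_distrib)
qed

lemma sph_hess_frame:
  fixes x :: "real^'n"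
  assumes "sph_grad h differentiable (at x within usphere)" and tan: "\<And>i. i < n \<Longrightarrow> inner (e i) x = 0"
  shows "sph_hess h x (\<Sum>i<n. v i *\<^sub>R e i) (\<Sum>i<n. v i *\<^sub>R e i) = qform n (\<lambda>i j. sph_hess h x (e i) (e j)) v"
proof -
  have lin: "linear (frechet_derivative (sph_grad h) (at x within usphere))"
    using assms(1) by (rule linear_frechet_derivative)
  have "inner (\<Sum>i<n. v i *\<^sub>R e i) x = 0"
    using tan by (simp add: inner_sum_left)
  then show ?thesis
    using tan unfolding qform_def
    by (simp add: sph_hess_tangent linear_sum[OF lin] linear_scale[OF lin] inner_sum_left inner_sum_right
        sum_distrib_left mult_ac) (subst sum.swap, simp add: mult_ac)
qed

text \<open>Along every unit-speed great circle through \<open>x\<close>, the difference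
  \<open>h1 - c * h2\<close> has its maximum at time 0. Great circles are geodesics, so its second
  derivative there is exactly the difference of the Hessian terms.\<close>

lemma touching_on_sphere:
  fixes h1 h2 :: "real^'n \<Rightarrow> real"
  assumes C1: "C2_on_sphere h1" and C2: "C2_on_sphere h2" and x: "x \<in> usphere"
    and le: "\<And>y. y \<in> usphere \<Longrightarrow> h1 y \<le> c * h2 y" and eq: "h1 x = c * h2 x"
    and u: "inner u x = 0"
  shows "inner (sph_grad h1 x) u = inner (c *\<^sub>R sph_grad h2 x) u"
    and "sph_hess h1 x u u \<le> c * sph_hess h2 x u u"
proof -
  have d: "h1 differentiable (at y within usphere)" "h2 differentiable (at y within usphere)"
    "sph_grad h1 differentiable (at y within usphere)" "sph_grad h2 differentiable (at y within usphere)"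
    if "y \<in> usphere" for y
    using C1 C2 that by (auto simp: C2_on_sphere_def differentiable_on_def)
  have nx: "norm x = 1" using x by simp
  have *: "inner (sph_grad h1 x) w = inner (c *\<^sub>R sph_grad h2 x) w \<and>
      sph_hess h1 x w w \<le> c * sph_hess h2 x w w" if w: "norm w = 1" "inner w x = 0" for w
  proof -
    let ?g = "\<lambda>t. cos t *\<^sub>R x + sin t *\<^sub>R w"
    let ?g' = "\<lambda>t. cos t *\<^sub>R w - sin t *\<^sub>R x"
    let ?W = "\<lambda>y. sph_grad h1 y - c *\<^sub>R sph_grad h2 y"
    let ?D1 = "frechet_derivative (sph_grad h1) (at x within usphere)"
    let ?D2 = "frechet_derivative (sph_grad h2) (at x within usphere)"
    note circ = has_vector_derivative_great_circle[OF nx w]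
    have g: "?g t \<in> usphere" for t
      using nx w by (rule great_circle_in_sphere)
    have f: "((\<lambda>s. h1 (?g s) - c * h2 (?g s)) has_real_derivative inner (?W (?g t)) (?g' t)) (at t)" for t
    proof -
      have "((\<lambda>y. h1 y - c * h2 y) has_derivative
          (\<lambda>v. inner (sph_grad h1 (?g t)) v - c * inner (sph_grad h2 (?g t)) v)) (at (?g t) within usphere)"
        by (intro has_derivative_diff has_derivative_mult_right sph_grad(2) d g)
      from circ[OF this] show ?thesis
        by (simp add: has_real_derivative_iff_has_vector_derivative inner_diff_left)
    qed
    have "(?W has_derivative (\<lambda>v. ?D1 v - c *\<^sub>R ?D2 v)) (at (?g 0) within usphere)"
      using d[OF x] by (auto intro!: has_derivative_diff has_derivative_scaleR_right
          simp: frechet_derivative_works[symmetric])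
    from circ[OF this]
    have "((\<lambda>s. ?W (?g s)) has_vector_derivative (?D1 w - c *\<^sub>R ?D2 w)) (at 0)"
      by simp
    \<comment> \<open>The acceleration of the circle is normal to the sphere, while both gradients
      are tangent. Hence the corresponding term of the product rule vanishes and only the Hessian
      part remains.\<close>
    moreover have "(?g' has_vector_derivative - x) (at 0)"
      by (auto intro!: derivative_eq_intros)
    ultimately have "((\<lambda>t. inner (?W (?g t)) (?g' t)) has_vector_derivative
        inner (?W (?g 0)) (- x) + inner (?D1 w - c *\<^sub>R ?D2 w) (?g' 0)) (at 0)"
      by (rule bounded_bilinear.has_vector_derivative[OF bounded_bilinear_inner])
    then have f': "((\<lambda>t. inner (?W (?g t)) (?g' t)) has_real_derivative
        inner (?D1 w - c *\<^sub>R ?D2 w) w) (at 0)"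
      using sph_grad(1)[OF x d(1)[OF x]] sph_grad(1)[OF x d(2)[OF x]]
      by (simp add: has_real_derivative_iff_has_vector_derivative inner_diff_left)
    have "h1 (?g t) - c * h2 (?g t) \<le> h1 (?g 0) - c * h2 (?g 0)" for t
      using le[OF g] eq by simp
    from second_derivative_at_max[OF f f' this] show ?thesis
      using w(2) by (simp add: inner_diff_left sph_hess_tangent)
  qed
  \<comment> \<open>Both relations pass from unit vectors to \<open>u\<close> by homogeneity, of
    degree one for the gradient and two for the Hessian.\<close>
  define w where "w = u /\<^sub>R norm u"
  have "inner (sph_grad h1 x) u = inner (c *\<^sub>R sph_grad h2 x) u \<and> sph_hess h1 x u u \<le> c * sph_hess h2 x u u"
  proof (cases "u = 0")
    case True
    then show ?thesis by (simp add: sph_hess_def)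
  next
    case False
    then have w: "norm w = 1" "inner w x = 0" and uw: "u = norm u *\<^sub>R w"
      using u by (auto simp: w_def)
    have "(norm u)\<^sup>2 * sph_hess h1 x w w \<le> (norm u)\<^sup>2 * (c * sph_hess h2 x w w)"
      using *[OF w] by (intro mult_left_mono) auto
    then have "sph_hess h1 x u u \<le> c * sph_hess h2 x u u"
      by (subst (1 2 3 4) uw) (simp only: sph_hess_scale[OF d(3)[OF x]] sph_hess_scale[OF d(4)[OF x]] mult_ac)
    moreover have "inner (sph_grad h1 x) u = inner (c *\<^sub>R sph_grad h2 x) u"
      using *[OF w] by (subst (1 2) uw) simp
    ultimately show ?thesis by blast
  qed
  then show "inner (sph_grad h1 x) u = inner (c *\<^sub>R sph_grad h2 x) u"
    and "sph_hess h1 x u u \<le> c * sph_hess h2 x u u"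
    by auto
qed

text \<open>The equation in \<open>is_solution\<close> is quantified over frames; existence of one
  is what makes it say something at \<open>x\<close>. The frame enumerates an orthonormal basis of
  the hyperplane orthogonal to \<open>x\<close>.\<close>

lemma ex_orthonormal_frame:
  fixes x :: "real^'n"
  assumes "x \<noteq> 0"
  shows "\<exists>e. orthonormal_frame x e"
proof -
  obtain B where B: "B \<subseteq> {v. inner x v = 0}" "pairwise Linear_Algebra.orthogonal B" "\<And>b. b \<in> B \<Longrightarrow> norm b = 1"
    "independent B" "card B = dim {v. inner x v = 0}"
    using orthonormal_basis_subspace[OF subspace_hyperplane] by metis
  have "finite B" "card B = CARD('n) - 1"
    using B(4,5) dim_hyperplane[OF assms] by (auto simp: independent_imp_finite)
  then obtain e where e: "bij_betw e {0..<CARD('n) - 1} B"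
    using ex_bij_betw_nat_finite by metis
  have "orthonormal_frame x e"
    unfolding orthonormal_frame_def
  proof (intro conjI allI impI)
    fix i assume i: "i < CARD('n) - 1"
    then have ei: "e i \<in> B" using e by (auto simp: bij_betw_def)
    then show "inner (e i) x = 0" using B(1) by (auto simp: inner_commute)
    fix j assume j: "j < CARD('n) - 1"
    then have ej: "e j \<in> B" using e by (auto simp: bij_betw_def)
    show "inner (e i) (e j) = (if i = j then 1 else 0)"
    proof (cases "i = j")
      case True
      then show ?thesis using B(3)[OF ei] by (simp add: dot_square_norm)
    next
      case False
      then have "e i \<noteq> e j" using e i j by (auto simp: bij_betw_def inj_on_def)
      then show ?thesis using False B(2) ei ej by (auto simp: pairwise_def Linear_Algebra.orthogonal_def)
    qed
  qed
  then show ?thesis by blast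
qed

section \<open>Comparison of solutions\<close>

lemma posdef_qform:
  assumes A: "A \<in> carrier_mat n n" and pd: "positive_definite_mat A" and v: "\<exists>i<n. v i \<noteq> 0"
  shows "0 < qform n (\<lambda>i j. A $$ (i, j)) v"
proof -
  have "Matrix.vec n v \<noteq> 0\<^sub>v n"
    using v by (metis index_vec index_zero_vec(1))
  then have "0 < scalar_prod (Matrix.vec n v) (A *\<^sub>v Matrix.vec n v)"
    using pd A by (auto simp: positive_definite_mat_def)
  also have "\<dots> = qform n (\<lambda>i j. A $$ (i, j)) v"
    using A by (auto simp: qform_def scalar_prod_def sum_distrib_left lessThan_atLeast0 mult_ac intro!: sum.cong)
  finally show ?thesis .
qed

text \<open>The form of \<open>hess_plus_mat\<close> is the Hessian form plus \<open>h x\<close>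
  times the squared length. At a touching point the Hessian forms are ordered and the values agree
  up to \<open>c\<close>, so monotonicity of the determinant applies.\<close>

lemma hess_plus_mat_touching:
  fixes h1 h2 :: "real^'n \<Rightarrow> real"
  assumes C: "C2_on_sphere h1" "C2_on_sphere h2" and x: "x \<in> usphere"
    and le: "\<And>y. y \<in> usphere \<Longrightarrow> h1 y \<le> c * h2 y" and eq: "h1 x = c * h2 x"
    and e: "orthonormal_frame x e"
    and pd: "positive_definite_mat (hess_plus_mat h1 x e)" "positive_definite_mat (hess_plus_mat h2 x e)"
  shows "0 < Determinant.det (hess_plus_mat h1 x e)"
    and "Determinant.det (hess_plus_mat h1 x e) \<le> c ^ (CARD('n) - 1) * Determinant.det (hess_plus_mat h2 x e)"
proof -
  define n where "n = CARD('n) - 1"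
  define H where "H h i j = sph_hess h x (e i) (e j) + (if i = j then h x else 0)" for h i j
  have ex: "\<And>i. i < n \<Longrightarrow> inner (e i) x = 0"
    using e by (auto simp: orthonormal_frame_def n_def)
  have car: "hess_plus_mat h x e \<in> carrier_mat n n" for h
    by (auto simp: hess_plus_mat_def hess_mat_def n_def)
  have idx: "hess_plus_mat h x e $$ (i, j) = H h i j" if "i < n" "j < n" for h i j
    using that by (auto simp: hess_plus_mat_def hess_mat_def n_def H_def)
  (* Outside of the index range the entries are arbitrary, so they are replaced by 0. *)
  define A where "A h i j = (if i < n \<and> j < n then H h i j else 0)" for h i j
  have mat_A: "hess_plus_mat h x e = Matrix.mat n n (\<lambda>(i, j). A h i j)" for h
    using car[of h] by (intro eq_matI) (auto simp: idx A_def)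
  \<comment> \<open>Symmetry of the Hessian is read off from \<open>positive_definite_mat\<close>,
    which contains it.\<close>
  have sym: "A h i j = A h j i" if "positive_definite_mat (hess_plus_mat h x e)" for h i j
  proof (cases "i < n \<and> j < n")
    case True
    have "transpose_mat (hess_plus_mat h x e) $$ (i, j) = hess_plus_mat h x e $$ (i, j)"
      using that by (simp add: positive_definite_mat_def)
    then show ?thesis
      using True car[of h] by (simp add: idx A_def)
  qed (auto simp: A_def)
  have pos: "0 < qform n (A h1) v" if "\<exists>i<n. v i \<noteq> 0" for v
  proof -
    have "qform n (\<lambda>i j. hess_plus_mat h1 x e $$ (i, j)) v = qform n (A h1) v"
      by (simp add: qform_def idx A_def)
    then show ?thesis
      using posdef_qform[OF car pd(1) that] by simp
  qed
  have d: "sph_grad h1 differentiable (at x within usphere)" "sph_grad h2 differentiable (at x within usphere)"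
    using C x by (auto simp: C2_on_sphere_def differentiable_on_def)
  have q: "qform n (A h) v = sph_hess h x (\<Sum>i<n. v i *\<^sub>R e i) (\<Sum>i<n. v i *\<^sub>R e i) + h x * (\<Sum>i<n. (v i)\<^sup>2)"
    if "sph_grad h differentiable (at x within usphere)" for h v
  proof -
    have "qform n (A h) v = (\<Sum>i<n. \<Sum>j<n. sph_hess h x (e i) (e j) * v i * v j + (if i = j then h x * (v i)\<^sup>2 else 0))"
      unfolding qform_def by (intro sum.cong) (auto simp: A_def H_def algebra_simps power2_eq_square)
    also have "\<dots> = qform n (\<lambda>i j. sph_hess h x (e i) (e j)) v + h x * (\<Sum>i<n. (v i)\<^sup>2)"
      by (simp add: qform_def sum.distrib sum_distrib_left)
    also have "qform n (\<lambda>i j. sph_hess h x (e i) (e j)) v = sph_hess h x (\<Sum>i<n. v i *\<^sub>R e i) (\<Sum>i<n. v i *\<^sub>R e i)"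
      using sph_hess_frame[OF that ex] by simp
    finally show ?thesis .
  qed
  have smult: "qform n (\<lambda>i j. c * A h2 i j) v = c * qform n (A h2) v" for v
    by (simp add: qform_def sum_distrib_left mult_ac)
  have le: "qform n (A h1) v \<le> qform n (\<lambda>i j. c * A h2 i j) v" for v
  proof -
    have "inner (\<Sum>i<n. v i *\<^sub>R e i) x = 0"
      using ex by (simp add: inner_sum_left)
    from touching_on_sphere(2)[OF C x le eq this] show ?thesis
      unfolding smult q[OF d(1)] q[OF d(2)] by (simp add: eq algebra_simps)
  qed
  have "0 < Determinant.det (Matrix.mat n n (\<lambda>(i, j). A h1 i j)) \<and>
      Determinant.det (Matrix.mat n n (\<lambda>(i, j). A h1 i j)) \<le> Determinant.det (Matrix.mat n n (\<lambda>(i, j). c * A h2 i j))"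
    by (rule det_mono_posdef) (use sym[OF pd(1)] sym[OF pd(2)] pos le in auto)
  \<comment> \<open>Pulling the scalar out of the determinant yields one factor \<open>c\<close> per
    row, hence the exponent \<open>CARD('n) - 1\<close>.\<close>
  moreover have "Matrix.mat n n (\<lambda>(i, j). c * A h2 i j) = c \<cdot>\<^sub>m Matrix.mat n n (\<lambda>(i, j). A h2 i j)"
    by (intro eq_matI) auto
  ultimately show "0 < Determinant.det (hess_plus_mat h1 x e)"
    and "Determinant.det (hess_plus_mat h1 x e) \<le> c ^ (CARD('n) - 1) * Determinant.det (hess_plus_mat h2 x e)"
    unfolding mat_A n_def[symmetric] by auto
qed

lemma solution_le:
  fixes \<phi> G_rad :: "real \<Rightarrow> real" and G f h\<^sub>1 h\<^sub>2 :: "real^'n \<Rightarrow> real"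
  assumes G_radial: "\<And>y. y \<noteq> 0 \<Longrightarrow> G y = G_rad (norm y)"
    and scaling: "\<And>s\<^sub>1 s\<^sub>2 \<mu>. s\<^sub>1 > 0 \<Longrightarrow> s\<^sub>2 > 0 \<Longrightarrow> \<mu> > 0 \<Longrightarrow>
        \<phi> (\<mu> * s\<^sub>1) * G_rad (\<mu> * s\<^sub>2) \<le> \<phi> s\<^sub>1 * G_rad s\<^sub>2 * \<mu> powi (1 - int CARD('n)) \<Longrightarrow> \<mu> \<ge> 1"
    and \<phi>_pos: "\<And>s. s > 0 \<Longrightarrow> \<phi> s > 0"
    and G_pos: "\<And>y. y \<noteq> 0 \<Longrightarrow> G y > 0"
    and sol1: "is_solution \<phi> G f h\<^sub>1"
    and sol2: "is_solution \<phi> G f h\<^sub>2"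
    and z: "z \<in> usphere"
  shows "h\<^sub>1 z \<le> h\<^sub>2 z"
proof -
  have pos: "h\<^sub>1 y > 0" "h\<^sub>2 y > 0" if "y \<in> usphere" for y
    using sol1 sol2 that by (auto simp: is_solution_def)
  have C: "C2_on_sphere h\<^sub>1" "C2_on_sphere h\<^sub>2"
    using sol1 sol2 by (auto simp: is_solution_def)
  then have "continuous_on usphere h\<^sub>1" "continuous_on usphere h\<^sub>2"
    by (auto simp: C2_on_sphere_def differentiable_imp_continuous_on)
  then have "continuous_on usphere (\<lambda>y. h\<^sub>1 y / h\<^sub>2 y)"
    using pos(2) by (intro continuous_on_divide) (auto simp: less_imp_neq[symmetric])
  \<comment> \<open>The sphere is compact, and \<open>z\<close> shows that it is nonempty.\<close>
  then obtain x where x: "x \<in> usphere" and max: "\<And>y. y \<in> usphere \<Longrightarrow> h\<^sub>1 y / h\<^sub>2 y \<le> h\<^sub>1 x / h\<^sub>2 x"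
    using continuous_attains_sup[OF compact_sphere, of 0 1 "\<lambda>y. h\<^sub>1 y / h\<^sub>2 y"] z by blast
  define c where "c = h\<^sub>1 x / h\<^sub>2 x"
  have c: "c > 0" using pos[OF x] by (simp add: c_def)
  have eq: "h\<^sub>1 x = c * h\<^sub>2 x" using pos[OF x] by (simp add: c_def)
  have le: "h\<^sub>1 y \<le> c * h\<^sub>2 y" if "y \<in> usphere" for y
    using max[OF that] pos(2)[OF that] by (simp add: c_def[symmetric] pos_divide_le_eq)
  have d: "h\<^sub>1 differentiable (at x within usphere)" "h\<^sub>2 differentiable (at x within usphere)"
    using C x by (auto simp: C2_on_sphere_def differentiable_on_def)
  have t: "inner (sph_grad h\<^sub>1 x) x = 0" "inner (sph_grad h\<^sub>2 x) x = 0"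
    using sph_grad(1)[OF x] d by auto
  have "sph_grad h\<^sub>1 x = c *\<^sub>R sph_grad h\<^sub>2 x"
  proof -
    \<comment> \<open>This difference is itself tangent, so it may serve as its own test
      direction.\<close>
    let ?u = "sph_grad h\<^sub>1 x - c *\<^sub>R sph_grad h\<^sub>2 x"
    have "inner ?u x = 0" using t by (simp add: inner_diff_left)
    from touching_on_sphere(1)[OF C x le eq this] have "inner ?u ?u = 0"
      by (simp add: inner_diff_left)
    then show ?thesis by simp
  qed
  then have grad: "grad_bar h\<^sub>1 x = c *\<^sub>R grad_bar h\<^sub>2 x"
    by (simp add: grad_bar_def eq algebra_simps)
  \<comment> \<open>The normal component of \<open>grad_bar\<close> is the positive value of the
    function. So both vectors are nonzero, and \<open>G\<close> there is given by
    \<open>G_rad\<close> at a positive radius.\<close>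
  have "inner (grad_bar h\<^sub>2 x) x = h\<^sub>2 x"
    using t x by (simp add: grad_bar_def inner_add_left dot_square_norm)
  then have nz2: "grad_bar h\<^sub>2 x \<noteq> 0"
    using pos(2)[OF x] by auto
  then have nz1: "grad_bar h\<^sub>1 x \<noteq> 0" using grad c by simp
  obtain e where e: "orthonormal_frame x e"
    using ex_orthonormal_frame[of x] x by fastforce
  define d1 d2 where "d1 = Determinant.det (hess_plus_mat h\<^sub>1 x e)" and "d2 = Determinant.det (hess_plus_mat h\<^sub>2 x e)"
  define P1 P2 where "P1 = \<phi> (h\<^sub>1 x) * G (grad_bar h\<^sub>1 x)" and "P2 = \<phi> (h\<^sub>2 x) * G (grad_bar h\<^sub>2 x)"
  have pd: "positive_definite_mat (hess_plus_mat h\<^sub>1 x e)" "positive_definite_mat (hess_plus_mat h\<^sub>2 x e)"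
    and "d1 * P1 = f x" "d2 * P2 = f x"
    using sol1 sol2 x e by (auto simp: is_solution_def d1_def d2_def P1_def P2_def mult_ac)
  then have f: "d2 * P2 = d1 * P1" by simp
  have "0 < d1" and dle: "d1 \<le> c ^ (CARD('n) - 1) * d2"
    using hess_plus_mat_touching[OF C x le eq e pd] by (auto simp: d1_def d2_def)
  then have d2: "0 < d2"
    using c by (smt (verit) zero_less_mult_pos zero_less_power)
  have "0 < P1"
    unfolding P1_def using \<phi>_pos G_pos pos(1)[OF x] nz1 by simp
  \<comment> \<open>The determinant bound is multiplied by \<open>P1\<close>; since both solutions
    have the same right-hand side, \<open>d1 * P1\<close> becomes \<open>d2 * P2\<close>, and then
    \<open>d2\<close> cancels.\<close>
  then have "d2 * P2 \<le> d2 * (c ^ (CARD('n) - 1) * P1)"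
    using mult_right_mono[OF dle, of P1] f by (simp add: mult_ac)
  then have "P2 \<le> P1 * c ^ (CARD('n) - 1)"
    using d2 by (simp add: mult.commute)
  moreover have "inverse c powi (1 - int CARD('n)) = c ^ (CARD('n) - 1)"
  proof -
    have "1 - int CARD('n) = - int (CARD('n) - 1)" by (simp add: of_nat_diff Suc_leI)
    then show ?thesis
      by (simp only: power_int_minus power_int_of_nat power_inverse inverse_inverse_eq)
  qed
  moreover have "inverse c * h\<^sub>1 x = h\<^sub>2 x" "inverse c * norm (grad_bar h\<^sub>1 x) = norm (grad_bar h\<^sub>2 x)"
    using c by (simp_all add: eq grad)
  \<comment> \<open>With \<mu> equal to \<open>inverse c\<close>, the arguments scaled from
    \<open>h\<^sub>1\<close> are those of \<open>h\<^sub>2\<close>, so this is the bound of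
    \<open>P2\<close> by \<open>P1\<close> in the form of the scaling hypothesis.\<close>
  ultimately have "\<phi> (inverse c * h\<^sub>1 x) * G_rad (inverse c * norm (grad_bar h\<^sub>1 x))
      \<le> \<phi> (h\<^sub>1 x) * G_rad (norm (grad_bar h\<^sub>1 x)) * inverse c powi (1 - int CARD('n))"
    using G_radial[OF nz1] G_radial[OF nz2] by (simp add: P1_def P2_def)
  then have "inverse c \<ge> 1"
    using scaling[of "h\<^sub>1 x" "norm (grad_bar h\<^sub>1 x)" "inverse c"] pos(1)[OF x] nz1 c by simp
  then have "c \<le> 1"
    using c by (simp add: one_le_inverse_iff)
  then show ?thesis
    using le[OF z] pos(2)[OF z] c mult_right_mono[of c 1 "h\<^sub>2 z"] by linarith
qed

theorem theorem3:
  fixes \<phi> G_rad :: "real \<Rightarrow> real" and G f h\<^sub>1 h\<^sub>2 :: "real^'n \<Rightarrow> real"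
  assumes n: "CARD('n) \<ge> 2"
    and \<phi>_pos: "\<And>s. s > 0 \<Longrightarrow> \<phi> s > 0"
    and G_pos: "\<And>y. y \<noteq> 0 \<Longrightarrow> G y > 0"
    and G_radial: "\<And>y. y \<noteq> 0 \<Longrightarrow> G y = G_rad (norm y)"
    and scaling: "\<And>s\<^sub>1 s\<^sub>2 \<mu>. s\<^sub>1 > 0 \<Longrightarrow> s\<^sub>2 > 0 \<Longrightarrow> \<mu> > 0 \<Longrightarrow>
        \<phi> (\<mu> * s\<^sub>1) * G_rad (\<mu> * s\<^sub>2) \<le> \<phi> s\<^sub>1 * G_rad s\<^sub>2 * \<mu> powi (1 - int CARD('n)) \<Longrightarrow> \<mu> \<ge> 1"
    and f_pos: "\<And>x. x \<in> usphere \<Longrightarrow> f x > 0"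
    and sol1: "is_solution \<phi> G f h\<^sub>1"
    and sol2: "is_solution \<phi> G f h\<^sub>2"
  shows "\<forall>x \<in> usphere. h\<^sub>1 x = h\<^sub>2 x"
proof
  fix x :: "real^'n" assume x: "x \<in> usphere"
  show "h\<^sub>1 x = h\<^sub>2 x"
  proof (rule antisym)
    show "h\<^sub>1 x \<le> h\<^sub>2 x"
      using G_radial scaling \<phi>_pos G_pos sol1 sol2 x by (rule solution_le)
    show "h\<^sub>2 x \<le> h\<^sub>1 x"
      using G_radial scaling \<phi>_pos G_pos sol2 sol1 x by (rule solution_le)
  qed
qed

end
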